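(* Let $n\ge1$, $0\le r\le n+1$, and let $G^r_n$ be any graph obtained from the linear crossed polyomino chain $G_n$ by deleting $r$ of its vertical edges. Then $$K\!f(G^r_n)=\frac{(n+1)(n^2+4n+r-2d+16)}{6},$$ where $d=d_1+d_{n+1}$ and $d_1,d_{n+1}$ are the degrees of vertices $1$ and $n+1$ in $G^r_n$.
   Context: For $n\geq1$, $G_n$ is the simple graph with vertex set $\{1,\ldots,n+1\}\cup\{1',\ldots,(n+1)'\}$ and edge set consisting of the vertical edges $ii'$ for $1\le i\le n+1$ together with, for each $1\le i\le n$, the edges $i(i+1)$, $i'(i+1)'$, $i(i+1)'$, $i'(i+1)$. For $0\le r\le n+1$, $\mathcal{G}^r_n$ is the set of graphs obtained from $G_n$ by deleting exactly $r$ of the vertical edges $ii'$. The Kirchhoff index is $K\!f(G)=\sum_{\{u,v\}}r_{uv}$, summed over unordered pairs of distinct vertices, where $r_{uv}$ is the effective resistance between $u$ and $v$ when every edge is a unit resistor. *)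

theory Defs
  imports Complex_Main
begin

text \<open>A simple graph is given by its vertices and its edges, an edge being a 2-element set.\<close>

record 'a graph =
  gverts :: "'a set"
  gedges :: "'a set set"

definition simple_graph :: "'a graph \<Rightarrow> bool" where
  "simple_graph G \<longleftrightarrow> finite (gverts G) \<and> (\<forall>e\<in>gedges G. e \<subseteq> gverts G \<and> card e = 2)"

definition gdegree :: "'a graph \<Rightarrow> 'a \<Rightarrow> nat" where
  "gdegree G v = card {e \<in> gedges G. v \<in> e}"

definition delete_edges :: "'a graph \<Rightarrow> 'a set set \<Rightarrow> 'a graph" where
  "delete_edges G D = G\<lparr>gedges := gedges G - D\<rparr>"

text \<open>Every edge is a unit resistor, so by Ohm's law the current from \<open>w\<close> to an adjacent
  \<open>x\<close> is \<open>\<phi> w - \<phi> x\<close>. The predicate says that \<open>\<phi>\<close> satisfies Kirchhoff's current law when a unit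
  current enters at \<open>u\<close> and leaves at \<open>v\<close>.\<close>

definition unit_current_potential :: "'a graph \<Rightarrow> 'a \<Rightarrow> 'a \<Rightarrow> ('a \<Rightarrow> real) \<Rightarrow> bool" where
  "unit_current_potential G u v \<phi> \<longleftrightarrow>
     (\<forall>w\<in>gverts G. (\<Sum>x | x \<in> gverts G \<and> {w, x} \<in> gedges G. \<phi> w - \<phi> x)
        = (if w = u then 1 else 0) - (if w = v then 1 else 0))"

text \<open>In a finite connected graph such a potential exists and is unique up to an additive
  constant, so the voltage \<open>\<phi> u - \<phi> v\<close> is well defined. For \<open>u\<close> and \<open>v\<close> in different
  components there is no such potential and the value is unspecified.\<close>

definition effective_resistance :: "'a graph \<Rightarrow> 'a \<Rightarrow> 'a \<Rightarrow> real" where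
  "effective_resistance G u v =
     (THE R. \<exists>\<phi>. unit_current_potential G u v \<phi> \<and> R = \<phi> u - \<phi> v)"

lemma unit_current_potential_swap:
  assumes "unit_current_potential G u v \<phi>"
  shows "unit_current_potential G v u (\<lambda>x. - \<phi> x)"
  unfolding unit_current_potential_def
proof
  fix w assume w: "w \<in> gverts G"
  let ?N = "{x. x \<in> gverts G \<and> {w, x} \<in> gedges G}"
  have "(\<Sum>x\<in>?N. - \<phi> w - - \<phi> x) = - (\<Sum>x\<in>?N. \<phi> w - \<phi> x)"
    by (simp flip: sum_negf)
  then show "(\<Sum>x\<in>?N. - \<phi> w - - \<phi> x) = (if w = v then 1 else 0) - (if w = u then 1 else 0)"
    using assms w unfolding unit_current_potential_def by simp
qed

lemma effective_resistance_commute: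
  "effective_resistance G u v = effective_resistance G v u"
proof -
  have *: "\<exists>\<psi>. unit_current_potential G b a \<psi> \<and> R = \<psi> b - \<psi> a"
    if "\<exists>\<phi>. unit_current_potential G a b \<phi> \<and> R = \<phi> a - \<phi> b" for a b and R :: real
    using that unit_current_potential_swap[of G a b] by fastforce
  have "(\<exists>\<phi>. unit_current_potential G u v \<phi> \<and> R = \<phi> u - \<phi> v) \<longleftrightarrow>
        (\<exists>\<phi>. unit_current_potential G v u \<phi> \<and> R = \<phi> v - \<phi> u)" for R
    using *[of u v R] *[of v u R] by blast
  then show ?thesis
    unfolding effective_resistance_def by simp
qed

text \<open>The effective resistance as a function of the unordered pair \<open>{u, v}\<close>; the description is
  proper because \<open>effective_resistance\<close> is symmetric.\<close>

definition pair_resistance :: "'a graph \<Rightarrow> 'a set \<Rightarrow> real" where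
  "pair_resistance G p = (THE R. \<exists>u v. p = {u, v} \<and> R = effective_resistance G u v)"

lemma pair_resistance_insert [simp]: "pair_resistance G {u, v} = effective_resistance G u v"
  unfolding pair_resistance_def
  by (rule the_equality) (auto simp: doubleton_eq_iff effective_resistance_commute)

definition kirchhoff_index :: "'a graph \<Rightarrow> real" where
  "kirchhoff_index G = (\<Sum>p | p \<subseteq> gverts G \<and> card p = 2. pair_resistance G p)"

text \<open>\<open>Unprimed i\<close> and \<open>Primed i\<close> are the vertices $i$ and $i'$.\<close>

datatype vertex = Unprimed nat | Primed nat

definition vertical_edges :: "nat \<Rightarrow> vertex set set" where
  "vertical_edges n = {{Unprimed i, Primed i} | i. 1 \<le> i \<and> i \<le> n + 1}"

definition crossed_chain :: "nat \<Rightarrow> vertex graph" where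
  "crossed_chain n =
     \<lparr>gverts = Unprimed ` {1..n + 1} \<union> Primed ` {1..n + 1},
      gedges = vertical_edges n \<union>
        (\<Union>i\<in>{1..n}. {{Unprimed i, Unprimed (i + 1)}, {Primed i, Primed (i + 1)},
                      {Unprimed i, Primed (i + 1)}, {Primed i, Unprimed (i + 1)}})\<rparr>"

definition crossed_chains :: "nat \<Rightarrow> nat \<Rightarrow> vertex graph set" where
  "crossed_chains n r =
     {delete_edges (crossed_chain n) D | D. D \<subseteq> vertical_edges n \<and> card D = r}"

lemma finite_vertical_edges: "finite (vertical_edges n)"
proof -
  have "vertical_edges n = (\<lambda>i. {Unprimed i, Primed i}) ` {1..n + 1}"
    unfolding vertical_edges_def by auto
  then show ?thesis by simp
qed

lemma simple_graph_crossed_chains: "G \<in> crossed_chains n r \<Longrightarrow> simple_graph G"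
  unfolding crossed_chains_def simple_graph_def delete_edges_def crossed_chain_def
    vertical_edges_def
  by auto

end

theory Submission
  imports Defs
begin

text \<open>Interchanging \<open>i\<close> and \<open>i'\<close> in a potential splits it into a symmetric and an antisymmetric part.
  On the symmetric part the network acts as a path, and on the antisymmetric part its Laplacian is
  diagonal. This gives an explicit Green kernel and the resistance
  \<open>\<bar>i - j\<bar> / 4 + c\<^sub>i / 2 + c\<^sub>j / 2\<close> between different columns \<open>i\<close> and \<open>j\<close>, and \<open>2 c\<^sub>i\<close>
  between \<open>i\<close> and \<open>i'\<close>, where \<open>1 / c\<^sub>i\<close> is the antisymmetric eigenvalue of column \<open>i\<close>.\<close>

subsection \<open>Resistances in finite graphs\<close>

text \<open>The degree terms are symmetric in the two functions. Exchanging the order of summation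
  in the adjacency terms swaps the roles of the functions, because \<open>{w, x}\<close> is
  unordered.\<close>

lemma sum_laplacian_commute:
  fixes \<phi> \<psi> :: "'a \<Rightarrow> real"
  assumes "finite V"
  shows "(\<Sum>w\<in>V. \<psi> w * (\<Sum>x | x \<in> V \<and> {w, x} \<in> E. \<phi> w - \<phi> x)) =
         (\<Sum>w\<in>V. \<phi> w * (\<Sum>x | x \<in> V \<and> {w, x} \<in> E. \<psi> w - \<psi> x))"
proof -
  have eq: "(\<Sum>w\<in>V. f w * (\<Sum>x | x \<in> V \<and> {w, x} \<in> E. g w - g x)) =
      (\<Sum>w\<in>V. \<Sum>x\<in>V. if {w, x} \<in> E then f w * g w else 0) -
      (\<Sum>w\<in>V. \<Sum>x\<in>V. if {w, x} \<in> E then f w * g x else 0)" for f g :: "'a \<Rightarrow> real"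
  proof -
    have "f w * (\<Sum>x | x \<in> V \<and> {w, x} \<in> E. g w - g x) =
        (\<Sum>x\<in>V. if {w, x} \<in> E then f w * g w - f w * g x else 0)" for w
      using assms by (simp add: sum_distrib_left right_diff_distrib flip: sum.inter_filter)
    then show ?thesis
      by (simp flip: sum_subtractf) (intro sum.cong refl, auto)
  qed
  have "(\<Sum>w\<in>V. \<Sum>x\<in>V. if {w, x} \<in> E then \<psi> w * \<phi> x else 0) =
        (\<Sum>w\<in>V. \<Sum>x\<in>V. if {w, x} \<in> E then \<phi> w * \<psi> x else 0)"
    by (subst sum.swap) (intro sum.cong refl, simp add: insert_commute mult.commute)
  then show ?thesis
    unfolding eq by (simp add: mult.commute[of "\<psi> _" "\<phi> _"] cong: if_cong)
qed

text \<open>Pairing with a test function \<open>\<psi>\<close> reads off a voltage of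
  \<open>\<psi>\<close>. If \<open>\<psi>\<close> is itself a potential for the same current,
  self-adjointness then equates the two voltages.\<close>

lemma unit_current_potential_test:
  assumes "finite (gverts G)" "u \<in> gverts G" "v \<in> gverts G"
    and "unit_current_potential G u v \<phi>"
  shows "(\<Sum>w\<in>gverts G. \<psi> w * (\<Sum>x | x \<in> gverts G \<and> {w, x} \<in> gedges G. \<phi> w - \<phi> x)) = \<psi> u - \<psi> v"
proof -
  have "(\<Sum>w\<in>gverts G. \<psi> w * (\<Sum>x | x \<in> gverts G \<and> {w, x} \<in> gedges G. \<phi> w - \<phi> x)) =
      (\<Sum>w\<in>gverts G. (if w = u then \<psi> w else 0) - (if w = v then \<psi> w else 0))"
    using assms(4) unfolding unit_current_potential_def by (intro sum.cong refl) auto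
  also have "\<dots> = \<psi> u - \<psi> v"
    using assms(1-3) by (simp add: sum_subtractf)
  finally show ?thesis .
qed

text \<open>Uniqueness comes from the self-adjointness of the Laplacian.\<close>

lemma effective_resistance_eqI:
  assumes "finite (gverts G)" "u \<in> gverts G" "v \<in> gverts G"
    and "unit_current_potential G u v \<phi>"
  shows "effective_resistance G u v = \<phi> u - \<phi> v"
  unfolding effective_resistance_def
proof (rule the_equality)
  fix R assume "\<exists>\<psi>. unit_current_potential G u v \<psi> \<and> R = \<psi> u - \<psi> v"
  then obtain \<psi> where "unit_current_potential G u v \<psi>" and R: "R = \<psi> u - \<psi> v" by blast
  then show "R = \<phi> u - \<phi> v"
    using sum_laplacian_commute[where \<phi> = \<phi> and \<psi> = \<psi> and E = "gedges G", OF assms(1)] assms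
    by (simp add: unit_current_potential_test)
qed (use assms in blast)

lemma effective_resistance_self: "effective_resistance G u u = 0"
proof -
  have "unit_current_potential G u u (\<lambda>_. 0)"
    by (simp add: unit_current_potential_def)
  then show ?thesis
    unfolding effective_resistance_def by (intro the_equality) auto
qed

text \<open>Diagonal terms vanish, and each 2-element set comes from exactly two ordered pairs of
  equal resistance. The ordered sum can then be split by columns.\<close>

lemma kirchhoff_index_double_sum:
  assumes "finite (gverts G)"
  shows "kirchhoff_index G = (\<Sum>u\<in>gverts G. \<Sum>v\<in>gverts G. effective_resistance G u v) / 2"
proof -
  let ?V = "gverts G" and ?r = "effective_resistance G"
  let ?P = "{p. p \<subseteq> ?V \<and> card p = 2}" and ?O = "{q \<in> ?V \<times> ?V. fst q \<noteq> snd q}"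
  have "(\<Sum>u\<in>?V. \<Sum>v\<in>?V. ?r u v) = (\<Sum>q\<in>?V \<times> ?V. ?r (fst q) (snd q))"
    by (simp add: sum.cartesian_product case_prod_beta)
  also have "\<dots> = (\<Sum>q\<in>?O. ?r (fst q) (snd q))"
    using assms by (intro sum.mono_neutral_right) (auto simp: effective_resistance_self)
  also have "\<dots> = (\<Sum>p\<in>?P. \<Sum>q\<in>{q \<in> ?O. {fst q, snd q} = p}. ?r (fst q) (snd q))"
    using assms by (intro sum.group[symmetric]) (auto simp: card_insert_if)
  also have "\<dots> = (\<Sum>p\<in>?P. 2 * pair_resistance G p)"
  proof (rule sum.cong[OF refl])
    fix p assume p: "p \<in> ?P"
    then obtain u v where uv: "p = {u, v}" "u \<noteq> v" by (auto simp: card_2_iff)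
    then have "{q \<in> ?O. {fst q, snd q} = p} = {(u, v), (v, u)}"
      using p by (auto simp: doubleton_eq_iff)
    then show "(\<Sum>q\<in>{q \<in> ?O. {fst q, snd q} = p}. ?r (fst q) (snd q)) = 2 * pair_resistance G p"
      using uv by (simp add: effective_resistance_commute[of G v u])
  qed
  finally show ?thesis
    by (simp add: kirchhoff_index_def flip: sum_distrib_left)
qed

text \<open>Edges have exactly two endpoints, so \<open>x\<close> corresponds to the edge
  \<open>{v, x}\<close>. This lets degrees be computed by the same neighbourhood sums as the
  Laplacian.\<close>

lemma gdegree_eq_card_neighbours:
  assumes "simple_graph G"
  shows "gdegree G v = card {x \<in> gverts G. {v, x} \<in> gedges G}"
proof -
  have "bij_betw (\<lambda>x. {v, x}) {x \<in> gverts G. {v, x} \<in> gedges G} {e \<in> gedges G. v \<in> e}"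
    unfolding bij_betw_def
  proof (intro conjI set_eqI iffI)
    show "inj_on (\<lambda>x. {v, x}) {x \<in> gverts G. {v, x} \<in> gedges G}"
      by (auto simp: inj_on_def doubleton_eq_iff)
    fix e assume e: "e \<in> {e \<in> gedges G. v \<in> e}"
    then have "card e = 2" "e \<subseteq> gverts G" "v \<in> e"
      using assms by (auto simp: simple_graph_def)
    then obtain x where "e = {v, x}" by (auto simp: card_2_iff)
    then show "e \<in> (\<lambda>x. {v, x}) ` {x \<in> gverts G. {v, x} \<in> gedges G}"
      using e \<open>e \<subseteq> gverts G\<close> by auto
  qed auto
  then show ?thesis
    unfolding gdegree_def by (simp add: bij_betw_same_card)
qed

subsection \<open>Crossed chains\<close>

definition vertical_edge :: "nat \<Rightarrow> vertex set" where
  "vertical_edge i = {Unprimed i, Primed i}"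

text \<open>\<open>K\<close> holds the columns whose vertical edge is kept rather than deleted,
  since the surviving edges are what contribute to degrees and to the Laplacian.\<close>

definition partial_chain :: "nat \<Rightarrow> nat set \<Rightarrow> vertex graph" where
  "partial_chain n K =
     delete_edges (crossed_chain n) (vertical_edge ` ({1..n + 1} - K))"

lemma vertical_edges_eq: "vertical_edges n = vertical_edge ` {1..n + 1}"
  by (auto simp: vertical_edges_def vertical_edge_def)

lemma inj_vertical_edge: "inj vertical_edge"
  by (auto simp: inj_def vertical_edge_def doubleton_eq_iff)

lemma crossed_chainsE:
  assumes "G \<in> crossed_chains n r"
  obtains K where "K \<subseteq> {1..n + 1}" "card K + r = n + 1" "G = partial_chain n K"
proof -
  obtain D where D: "D \<subseteq> vertical_edges n" "card D = r" "G = delete_edges (crossed_chain n) D"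
    using assms by (auto simp: crossed_chains_def)
  then obtain L where L: "L \<subseteq> {1..n + 1}" "D = vertical_edge ` L"
    by (auto simp: vertical_edges_eq subset_image_iff)
  show ?thesis
  proof
    show "{1..n + 1} - L \<subseteq> {1..n + 1}" by auto
    have "card L = r"
      using D L inj_vertical_edge by (simp add: card_image inj_on_subset[OF inj_vertical_edge])
    moreover have "card L \<le> n + 1"
      using card_mono[OF _ L(1)] by simp
    ultimately show "card ({1..n + 1} - L) + r = n + 1"
      using L(1) by (simp add: card_Diff_subset finite_subset)
    have "{1..n + 1} - ({1..n + 1} - L) = L" using L(1) by auto
    then show "G = partial_chain n ({1..n + 1} - L)"
      using D L by (simp add: partial_chain_def)
  qed
qed

fun column :: "vertex \<Rightarrow> nat" where
  "column (Unprimed i) = i"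
| "column (Primed i) = i"

fun sign :: "vertex \<Rightarrow> real" where
  "sign (Unprimed i) = 1"
| "sign (Primed i) = -1"

fun opposite :: "vertex \<Rightarrow> vertex" where
  "opposite (Unprimed i) = Primed i"
| "opposite (Primed i) = Unprimed i"

definition adjacent_columns :: "nat \<Rightarrow> nat \<Rightarrow> nat set" where
  "adjacent_columns n k = {j \<in> {1..n + 1}. j = k + 1 \<or> k = j + 1}"

lemma column_opposite [simp]: "column (opposite w) = column w"
  by (cases w) auto

lemma sign_opposite [simp]: "sign (opposite w) = - sign w"
  by (cases w) auto

lemma gverts_partial_chain:
  "gverts (partial_chain n K) = Unprimed ` {1..n + 1} \<union> Primed ` {1..n + 1}"
  by (simp add: partial_chain_def delete_edges_def crossed_chain_def)

lemma finite_gverts_partial_chain [simp]: "finite (gverts (partial_chain n K))"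
  by (simp add: gverts_partial_chain)

lemma in_gverts_partial_chain: "w \<in> gverts (partial_chain n K) \<longleftrightarrow> column w \<in> {1..n + 1}"
  by (cases w) (auto simp: gverts_partial_chain)

lemma sum_gverts_partial_chain:
  "(\<Sum>w\<in>gverts (partial_chain n K). f w) = (\<Sum>i=1..n + 1. f (Unprimed i) + f (Primed i))"
proof -
  have "(\<Sum>w\<in>gverts (partial_chain n K). f w) =
      sum f (Unprimed ` {1..n + 1}) + sum f (Primed ` {1..n + 1})"
    unfolding gverts_partial_chain by (rule sum.union_disjoint) auto
  then show ?thesis
    by (simp add: sum.reindex inj_on_def sum.distrib)
qed

lemma neighbours_partial_chain:
  assumes "K \<subseteq> {1..n + 1}" "w \<in> gverts (partial_chain n K)"
  shows "{x. x \<in> gverts (partial_chain n K) \<and> {w, x} \<in> gedges (partial_chain n K)} =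
    Unprimed ` adjacent_columns n (column w) \<union> Primed ` adjacent_columns n (column w) \<union>
    (if column w \<in> K then {opposite w} else {})"
proof (intro set_eqI)
  fix x
  show "x \<in> {x. x \<in> gverts (partial_chain n K) \<and> {w, x} \<in> gedges (partial_chain n K)} \<longleftrightarrow>
    x \<in> Unprimed ` adjacent_columns n (column w) \<union> Primed ` adjacent_columns n (column w) \<union>
    (if column w \<in> K then {opposite w} else {})"
    using assms
    by (cases w; cases x)
      (auto simp: gverts_partial_chain adjacent_columns_def partial_chain_def delete_edges_def
        crossed_chain_def vertical_edges_eq vertical_edge_def doubleton_eq_iff image_iff)
qed

lemma finite_adjacent_columns [simp]: "finite (adjacent_columns n k)"
  by (simp add: adjacent_columns_def)

lemma self_notin_adjacent_columns: "k \<notin> adjacent_columns n k"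
  by (simp add: adjacent_columns_def)

lemma sum_neighbours_partial_chain:
  fixes f :: "vertex \<Rightarrow> 'a::comm_monoid_add"
  assumes "K \<subseteq> {1..n + 1}" "w \<in> gverts (partial_chain n K)"
  shows "(\<Sum>x | x \<in> gverts (partial_chain n K) \<and> {w, x} \<in> gedges (partial_chain n K). f x) =
    (\<Sum>j\<in>adjacent_columns n (column w). f (Unprimed j) + f (Primed j)) +
    (if column w \<in> K then f (opposite w) else 0)"
proof -
  let ?A = "adjacent_columns n (column w)"
  \<comment> \<open>No column is adjacent to itself, so the vertical neighbour is separate from the
    others and its term splits off.\<close>
  have "opposite w \<notin> Unprimed ` ?A \<union> Primed ` ?A"
    using self_notin_adjacent_columns[of "column w" n] by (cases w) auto
  then have "(\<Sum>x | x \<in> gverts (partial_chain n K) \<and> {w, x} \<in> gedges (partial_chain n K). f x) =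
      sum f (Unprimed ` ?A \<union> Primed ` ?A) + (if column w \<in> K then f (opposite w) else 0)"
    unfolding neighbours_partial_chain[OF assms] by (simp add: add.commute)
  also have "sum f (Unprimed ` ?A \<union> Primed ` ?A) = sum f (Unprimed ` ?A) + sum f (Primed ` ?A)"
    by (rule sum.union_disjoint) auto
  finally show ?thesis
    by (simp add: sum.reindex inj_on_def sum.distrib)
qed

lemma adjacent_columns_eq:
  assumes "1 \<le> n" "k \<in> {1..n + 1}"
  shows "adjacent_columns n k = (if k = 1 then {2} else if k = n + 1 then {n} else {k - 1, k + 1})"
  using assms by (auto simp: adjacent_columns_def)

lemma card_adjacent_columns:
  assumes "1 \<le> n" "k \<in> {1..n + 1}"
  shows "card (adjacent_columns n k) = (if k = 1 \<or> k = n + 1 then 1 else 2)"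
  using assms by (auto simp: adjacent_columns_eq)

lemma simple_graph_partial_chain: "simple_graph (partial_chain n K)"
  unfolding simple_graph_def partial_chain_def delete_edges_def crossed_chain_def vertical_edges_def
  by auto

lemma gdegree_partial_chain:
  assumes "K \<subseteq> {1..n + 1}" "w \<in> gverts (partial_chain n K)"
  shows "gdegree (partial_chain n K) w =
    2 * card (adjacent_columns n (column w)) + of_bool (column w \<in> K)"
  \<comment> \<open>Summing the constant 1 counts the neighbours.\<close>
  using sum_neighbours_partial_chain[OF assms, of "\<lambda>_. 1 :: nat"]
  by (simp add: gdegree_eq_card_neighbours[OF simple_graph_partial_chain])

subsection \<open>The Green kernel\<close>

text \<open>This is the reciprocal of the antisymmetric eigenvalue at column \<open>k\<close>. A
  kept vertical edge counts twice there: once in the degree and once because the opposite vertex has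
  the opposite value.\<close>

definition column_weight :: "nat \<Rightarrow> nat set \<Rightarrow> nat \<Rightarrow> real" where
  "column_weight n K k = 1 / (2 * real (card (adjacent_columns n k)) + 2 * of_bool (k \<in> K))"

text \<open>A unit source at \<open>u\<close> is half symmetric and half antisymmetric. On symmetric
  functions the Laplacian is twice that of a path, for which \<open>- \<bar>k - i\<bar> / 2\<close>
  inverts an interior point source; this gives the factor 1/8. The antisymmetric half is divided by
  its eigenvalue.\<close>

definition green :: "nat \<Rightarrow> nat set \<Rightarrow> vertex \<Rightarrow> vertex \<Rightarrow> real" where
  "green n K u w = - \<bar>real (column w) - real (column u)\<bar> / 8 +
     (if column w = column u then sign u * sign w * column_weight n K (column u) / 2 else 0)"

text \<open>The second difference of an absolute value is 2 at its kink and 0 elsewhere. An end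
  column lacks its outer neighbour, which would have contributed 1.\<close>

lemma sum_adjacent_columns_dist:
  assumes "1 \<le> n" "k \<in> {1..n + 1}" "i \<in> {1..n + 1}"
  shows "(\<Sum>j\<in>adjacent_columns n k. \<bar>real j - real i\<bar> - \<bar>real k - real i\<bar>) =
    2 * of_bool (k = i) - of_bool (k = 1 \<or> k = n + 1)"
proof -
  consider "k = 1" | "k = n + 1" "k \<noteq> 1" | "k \<noteq> 1" "k \<noteq> n + 1" by blast
  then show ?thesis
  proof cases
    case 3
    then have "real (k - 1) = real k - 1" "k - 1 \<noteq> k + 1" using assms by auto
    moreover have "k < i \<or> k = i \<or> i < k" by linarith
    ultimately show ?thesis using 3 assms by (auto simp: adjacent_columns_eq)
  qed (use assms in \<open>auto simp: adjacent_columns_eq\<close>)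
qed

text \<open>The defect at the end columns does not depend on \<open>u\<close>, so it cancels in the potential
  \<open>green n K u - green n K v\<close>.\<close>

lemma laplacian_green:
  assumes "1 \<le> n" "K \<subseteq> {1..n + 1}"
    and u: "u \<in> gverts (partial_chain n K)" and w: "w \<in> gverts (partial_chain n K)"
  shows "(\<Sum>x | x \<in> gverts (partial_chain n K) \<and> {w, x} \<in> gedges (partial_chain n K).
      green n K u w - green n K u x) =
    of_bool (w = u) - of_bool (column w = 1 \<or> column w = n + 1) / 4"
proof -
  define k i where "k = column w" and "i = column u"
  let ?A = "adjacent_columns n k"
  \<comment> \<open>\<open>t\<close> is the drop across the column of \<open>w\<close>, hence twice
    the antisymmetric part of the kernel at \<open>w\<close>.\<close>
  define t where "t = (if k = i then sign u * sign w * column_weight n K i else 0)"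
  have ki: "k \<in> {1..n + 1}" "i \<in> {1..n + 1}"
    using u w by (auto simp: in_gverts_partial_chain k_def i_def)
  have self: "green n K u w = t / 2 - \<bar>real k - real i\<bar> / 8"
    and opp: "green n K u w - green n K u (opposite w) = t"
    by (auto simp: green_def t_def k_def i_def)
  have pair: "green n K u (Unprimed j) + green n K u (Primed j) = - \<bar>real j - real i\<bar> / 4" for j
    by (simp add: green_def i_def)
  \<comment> \<open>Adding both vertices of an adjacent column cancels the signed terms, so only
    distances remain.\<close>
  have "(\<Sum>j\<in>?A. (green n K u w - green n K u (Unprimed j)) +
        (green n K u w - green n K u (Primed j))) =
      (\<Sum>j\<in>?A. 2 * green n K u w - (green n K u (Unprimed j) + green n K u (Primed j)))"
    by (intro sum.cong refl) simp
  also have "\<dots> = (\<Sum>j\<in>?A. t + (\<bar>real j - real i\<bar> - \<bar>real k - real i\<bar>) / 4)"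
    unfolding pair self by (intro sum.cong refl) (simp add: field_simps)
  also have "\<dots> = card ?A * t + (\<Sum>j\<in>?A. \<bar>real j - real i\<bar> - \<bar>real k - real i\<bar>) / 4"
    by (simp add: sum.distrib sum_divide_distrib)
  also have "\<dots> = card ?A * t + of_bool (k = i) / 2 - of_bool (k = 1 \<or> k = n + 1) / 4"
    by (simp add: sum_adjacent_columns_dist[OF assms(1) ki] diff_divide_distrib)
  finally have "(\<Sum>x | x \<in> gverts (partial_chain n K) \<and> {w, x} \<in> gedges (partial_chain n K).
      green n K u w - green n K u x) =
      (card ?A + of_bool (k \<in> K)) * t + of_bool (k = i) / 2 - of_bool (k = 1 \<or> k = n + 1) / 4"
    using opp by (simp add: sum_neighbours_partial_chain[OF assms(2) w] k_def algebra_simps)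
  \<comment> \<open>Within the column of \<open>u\<close> the antisymmetric part contributes 1/2 at
    \<open>u\<close> and -1/2 at the opposite vertex; the symmetric part adds 1/2 at both.\<close>
  moreover have "(card ?A + of_bool (k \<in> K)) * t + of_bool (k = i) / 2 = of_bool (w = u)"
  proof (cases "k = i")
    case True
    have "(card ?A + of_bool (k \<in> K)) * t =
        sign u * sign w * ((card ?A + of_bool (k \<in> K)) * column_weight n K k)"
      using True by (simp add: t_def)
    also have "(card ?A + of_bool (k \<in> K)) * column_weight n K k = 1 / 2"
      using card_adjacent_columns[OF assms(1) ki(1)]
      by (simp add: column_weight_def field_simps)
    finally have "(card ?A + of_bool (k \<in> K)) * t = sign u * sign w / 2"
      by simp
    then show ?thesis
      using True by (cases u; cases w) (auto simp: k_def i_def)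
  qed (auto simp: t_def k_def i_def)
  ultimately show ?thesis by (simp add: k_def)
qed

text \<open>The difference of the kernels at \<open>u\<close> and \<open>v\<close> is a unit current
  potential. Within one column the last term turns the sum of the weights into 0 for equal vertices
  and into twice the weight for opposite ones.\<close>

lemma effective_resistance_partial_chain:
  assumes "1 \<le> n" "K \<subseteq> {1..n + 1}"
    and u: "u \<in> gverts (partial_chain n K)" and v: "v \<in> gverts (partial_chain n K)"
  shows "effective_resistance (partial_chain n K) u v =
    column_weight n K (column u) / 2 + column_weight n K (column v) / 2 +
    \<bar>real (column u) - real (column v)\<bar> / 4 -
    (if column u = column v then sign u * sign v * column_weight n K (column u) else 0)"
proof -
  let ?\<phi> = "\<lambda>x. green n K u x - green n K v x"
  have "unit_current_potential (partial_chain n K) u v ?\<phi>"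
    unfolding unit_current_potential_def
  proof
    fix w assume w: "w \<in> gverts (partial_chain n K)"
    let ?N = "{x. x \<in> gverts (partial_chain n K) \<and> {w, x} \<in> gedges (partial_chain n K)}"
    have "(\<Sum>x\<in>?N. ?\<phi> w - ?\<phi> x) =
        (\<Sum>x\<in>?N. green n K u w - green n K u x) - (\<Sum>x\<in>?N. green n K v w - green n K v x)"
      by (simp add: algebra_simps flip: sum_subtractf)
    then show "(\<Sum>x\<in>?N. ?\<phi> w - ?\<phi> x) = (if w = u then 1 else 0) - (if w = v then 1 else 0)"
      by (simp add: laplacian_green[OF assms(1,2) _ w] u v)
  qed
  then have "effective_resistance (partial_chain n K) u v = ?\<phi> u - ?\<phi> v"
    using u v by (intro effective_resistance_eqI) auto
  moreover have "sign x * sign x = 1" for x by (cases x) auto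
  ultimately show ?thesis
    by (auto simp: green_def abs_minus_commute mult.commute)
qed

subsection \<open>Summation\<close>

text \<open>Passing from \<open>N\<close> to \<open>Suc N\<close> adds a row and a column of
  distances to the new point, each with sum \<open>N * (N + 1) / 2\<close>.\<close>

lemma sum_abs_diff:
  "(\<Sum>i=1..N. \<Sum>j=1..N. \<bar>real i - real j\<bar>) = (real N ^ 3 - real N) / 3"
proof (induction N)
  case (Suc N)
  have gauss: "(\<Sum>i=1..N. real (Suc N) - real i) = real N * (real N + 1) / 2" for N
    by (induction N) (auto simp: sum.distrib sum_subtractf algebra_simps)
  have "(\<Sum>i=1..N. \<bar>real i - real (Suc N)\<bar>) = real N * (real N + 1) / 2"
    "(\<Sum>i=1..N. \<bar>real (Suc N) - real i\<bar>) = real N * (real N + 1) / 2"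
    unfolding gauss[symmetric] by (intro sum.cong refl; simp)+
  moreover have "(\<Sum>i=1..Suc N. \<Sum>j=1..Suc N. \<bar>real i - real j\<bar>) =
      (\<Sum>i=1..N. \<Sum>j=1..N. \<bar>real i - real j\<bar>) +
      (\<Sum>i=1..N. \<bar>real i - real (Suc N)\<bar>) + (\<Sum>i=1..N. \<bar>real (Suc N) - real i\<bar>)"
    by (simp add: sum.distrib)
  ultimately have "(\<Sum>i=1..Suc N. \<Sum>j=1..Suc N. \<bar>real i - real j\<bar>) =
      (real N ^ 3 - real N) / 3 + real N * (real N + 1) / 2 + real N * (real N + 1) / 2"
    using Suc by (simp only:)
  also have "\<dots> = (real (Suc N) ^ 3 - real (Suc N)) / 3"
    by (simp add: field_simps power3_eq_cube)
  finally show ?case .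
qed simp

lemma kirchhoff_index_partial_chain:
  assumes "1 \<le> n" "K \<subseteq> {1..n + 1}"
  defines "N \<equiv> n + 1"
  shows "kirchhoff_index (partial_chain n K) =
    (real N ^ 3 - real N) / 6 + 2 * real N * (\<Sum>i=1..N. column_weight n K i)"
proof -
  let ?r = "effective_resistance (partial_chain n K)" and ?c = "column_weight n K"
  \<comment> \<open>Over the four pairs between two columns the sign products sum to zero, so the
    case \<open>i = j\<close> takes the same form as the others.\<close>
  have block: "(?r (Unprimed i) (Unprimed j) + ?r (Unprimed i) (Primed j)) +
      (?r (Primed i) (Unprimed j) + ?r (Primed i) (Primed j)) =
      2 * ?c i + 2 * ?c j + \<bar>real i - real j\<bar>" if "i \<in> {1..N}" "j \<in> {1..N}" for i j
    using that assms
    by (simp add: effective_resistance_partial_chain in_gverts_partial_chain)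
  have "2 * kirchhoff_index (partial_chain n K) =
      (\<Sum>i=1..N. \<Sum>j=1..N. 2 * ?c i + 2 * ?c j + \<bar>real i - real j\<bar>)"
    unfolding kirchhoff_index_double_sum[OF finite_gverts_partial_chain]
      sum_gverts_partial_chain N_def[symmetric]
    using block by (simp flip: sum.distrib)
  also have "\<dots> = 4 * real N * (\<Sum>i=1..N. ?c i) + (real N ^ 3 - real N) / 3"
    unfolding sum_abs_diff[symmetric]
    by (simp add: sum.distrib flip: sum_distrib_left)
  finally show ?thesis by simp
qed

lemma sum_column_weight:
  assumes "1 \<le> n" "K \<subseteq> {1..n + 1}"
  shows "(\<Sum>i=1..n + 1. column_weight n K i) =
    (real n + 3) / 4 - real (card K) / 12 - (of_bool (1 \<in> K) + of_bool (n + 1 \<in> K)) / 6"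
proof -
  \<comment> \<open>The weight is 1/4 or 1/6 at an inner column and 1/2 or 1/4 at an end, the second
    value applying when the vertical edge is kept. The indicators interpolate these four
    values.\<close>
  have "column_weight n K i = 1 / 4 - of_bool (i \<in> K) / 12 +
      (if i = 1 then 1 / 4 - of_bool (1 \<in> K) / 6 else 0) +
      (if i = n + 1 then 1 / 4 - of_bool (n + 1 \<in> K) / 6 else 0)" if "i \<in> {1..n + 1}" for i
    using card_adjacent_columns[OF assms(1) that] assms(1) by (auto simp: column_weight_def)
  then have "(\<Sum>i=1..n + 1. column_weight n K i) =
      (\<Sum>i=1..n + 1. 1 / 4 - of_bool (i \<in> K) / 12 +
        (if i = 1 then 1 / 4 - of_bool (1 \<in> K) / 6 else 0) +
        (if i = n + 1 then 1 / 4 - of_bool (n + 1 \<in> K) / 6 else 0))"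
    by (intro sum.cong refl)
  also have "\<dots> = (real n + 1) / 4 - (\<Sum>i=1..n + 1. of_bool (i \<in> K)) / 12 +
      (1 / 4 - of_bool (1 \<in> K) / 6) + (1 / 4 - of_bool (n + 1 \<in> K) / 6)"
    by (simp only: sum.distrib sum_subtractf sum.delta finite_atLeastAtMost flip: sum_divide_distrib)
      simp
  also have "(\<Sum>i=1..n + 1. of_bool (i \<in> K)) = real (card K)"
    using assms(2) by (simp add: inf.absorb2 del: sum.cl_ivl_Suc)
  finally show ?thesis by (simp add: field_simps)
qed

theorem theorem4p2:
  fixes n r :: nat and G :: "vertex graph" and d :: nat
  assumes "1 \<le> n" and "r \<le> n + 1"
    and "G \<in> crossed_chains n r"
    and "d = gdegree G (Unprimed 1) + gdegree G (Unprimed (n + 1))"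
  shows "kirchhoff_index G =
    (real n + 1) * ((real n)^2 + 4 * real n + real r - 2 * real d + 16) / 6"
proof -
  obtain K where K: "K \<subseteq> {1..n + 1}" "card K + r = n + 1" and G: "G = partial_chain n K"
    using assms(3) by (rule crossed_chainsE)
  \<comment> \<open>Each end vertex has two neighbours in its single adjacent column, so
    \<open>d - 4\<close> counts the kept vertical edges at the ends, which is the end correction in
    the sum of weights.\<close>
  have d: "real d = 4 + of_bool (1 \<in> K) + of_bool (n + 1 \<in> K)"
    using assms(1) K(1) unfolding assms(4) G
    by (simp add: gdegree_partial_chain in_gverts_partial_chain card_adjacent_columns)
  have r: "real r = real n + 1 - real (card K)"
    using K(2) by linarith
  show ?thesis
    unfolding G kirchhoff_index_partial_chain[OF assms(1) K(1)]
      sum_column_weight[OF assms(1) K(1)] d r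
    by (simp add: field_simps power2_eq_square power3_eq_cube)
qed

end
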